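(* Let $X$ and $Y$ be amiable discrete real-valued random variables with support sets and probability mass functions $\{S_X, p_X(x)\}$ and $\{S_Y, p_Y(y)\}$, respectively, and with joint support set and joint probability mass function $\{S_{XY}, p_{XY}(x,y)\}$. If $X$ and $Y$ are independent, then $$S_{XY} = S_X\times S_Y .$$
   Context: The underlying probability space is $(\mathbb{R}^2, \mathbb{B}^2, P)$, where $\mathbb{B}^k$ denotes the Borel $\sigma$-field on $\mathbb{R}^k$; $X$ and $Y$ are the two coordinate maps, so $P$ is the joint distribution of $(X,Y)$. $X$ and $Y$ are independent iff $P[(X\in B_1) \text{ and } (Y\in B_2)] = P(X\in B_1)\cdot P(Y\in B_2)$ for all $B_1,B_2\in\mathbb{B}^1$. Support sets: with $\mathcal{B}[(x,y),\epsilon]$ the open Euclidean ball of radius $\epsilon$ centered at $(x,y)$, $$S_{XY} = \{(x,y)\in\mathbb{R}^2 : P\{(X,Y)\in\mathcal{B}[(x,y),\epsilon]\}>0 \text{ for all } \epsilon>0\},$$ $$S_X = \{x\in\mathbb{R} : P[X\in(x-\epsilon,x+\epsilon)]>0 \text{ for all } \epsilon>0\},$$ and $S_Y$ is defined analogously. A random variable (or random vector) is discrete if it takes values in some finite or countably infinite set with probability 1. The probability mass functions are $p_{XY}(x,y)=P(X=x \text{ and } Y=y)$, $p_X(x)=P(X=x)$, $p_Y(y)=P(Y=y)$. A discrete random variable $X$ is called amiable iff $S_X = \{x\in\mathbb{R}: p_X(x)>0\}$, and likewise for $Y$. *)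

theory Defs
  imports "HOL-Probability.Probability"
begin

text \<open>
  The definitions below are used with \<^typ>\<open>real\<close>- and \<^typ>\<open>real \<times> real\<close>-valued random variables.
  On \<^typ>\<open>real\<close>, \<^term>\<open>ball x e\<close> is the open interval from \<^term>\<open>x - e\<close> to \<^term>\<open>x + e\<close>; on
  \<^typ>\<open>real \<times> real\<close> the library's product metric is the Euclidean one, so \<^term>\<open>ball (x, y) e\<close> is
  the open Euclidean disc.
\<close>

definition support_set :: "'w measure \<Rightarrow> ('w \<Rightarrow> 'a::metric_space) \<Rightarrow> 'a set" where
  "support_set M Z = {z. \<forall>e>0. measure M {w \<in> space M. Z w \<in> ball z e} > 0}"

definition prob_mass :: "'w measure \<Rightarrow> ('w \<Rightarrow> 'a) \<Rightarrow> 'a \<Rightarrow> real" where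
  "prob_mass M Z z = measure M {w \<in> space M. Z w = z}"

definition discrete_rv :: "'w measure \<Rightarrow> ('w \<Rightarrow> 'a) \<Rightarrow> bool" where
  "discrete_rv M Z \<longleftrightarrow> (\<exists>A. countable A \<and> (AE w in M. Z w \<in> A))"

definition amiable :: "'w measure \<Rightarrow> ('w \<Rightarrow> real) \<Rightarrow> bool" where
  "amiable M Z \<longleftrightarrow> discrete_rv M Z \<and> support_set M Z = {z. prob_mass M Z z > 0}"

end

theory Submission
  imports Defs
begin

text \<open>
  Balls of the Euclidean product metric and products of balls are cofinal in each other:
  a ball around \<open>(x, y)\<close> projects into the balls of the same radius around \<open>x\<close> and \<open>y\<close>, and it
  contains the product of the balls of half the radius.  The projections show that a support point
  of the joint distribution has support points of the marginals as coordinates.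
  Conversely, independence turns the mass of the product of two balls into the product of their
  masses, which is positive when \<open>x\<close> and \<open>y\<close> are support points of the marginals.
  The argument compares neighbourhoods only, so it is carried out for independent random variables
  with values in a metric space and then applied to the two coordinates of the plane.
\<close>

lemma ball_Times_ball_subset_ball:
  fixes x :: "'a::metric_space" and y :: "'b::metric_space"
  shows "ball x (e / 2) \<times> ball y (e / 2) \<subseteq> ball (x, y) e"
proof clarsimp
  fix a b assume "dist x a * 2 < e" "dist y b * 2 < e"
  moreover have "dist (x, y) (a, b) \<le> dist x a + dist y b"
    by (simp add: dist_Pair_Pair sqrt_sum_squares_le_sum)
  ultimately show "dist (x, y) (a, b) < e"
    by linarith
qed

text \<open>
  The Borel sets of a product of non-separable metric spaces can exceed the product
  \<open>\<sigma>\<close>-algebra, so the pair of two Borel measurable maps can fail to be Borel measurable.  Balls are nevertheless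
  harmless, as the distance to a fixed point is a continuous function of the two coordinate
  distances.
\<close>

lemma pair_in_ball_measurable:
  fixes Z :: "'w \<Rightarrow> 'a::metric_space" and W :: "'w \<Rightarrow> 'b::metric_space"
  assumes Z: "Z \<in> borel_measurable M" and W: "W \<in> borel_measurable M"
  shows "{w \<in> space M. (Z w, W w) \<in> ball (x, y) e} \<in> sets M"
proof -
  have [measurable]: "(\<lambda>w. dist x (Z w)) \<in> borel_measurable M"
    by (rule borel_measurable_continuous_on[OF _ Z]) (intro continuous_intros)
  have [measurable]: "(\<lambda>w. dist y (W w)) \<in> borel_measurable M"
    by (rule borel_measurable_continuous_on[OF _ W]) (intro continuous_intros)
  show ?thesis
    unfolding mem_ball dist_Pair_Pair by measurable
qed

lemma (in prob_space) support_set_pair_subset: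
  fixes Z :: "'a \<Rightarrow> 'b::metric_space" and W :: "'a \<Rightarrow> 'c::metric_space"
  assumes "Z \<in> borel_measurable M" "W \<in> borel_measurable M"
  shows "support_set M (\<lambda>w. (Z w, W w)) \<subseteq> support_set M Z \<times> support_set M W"
proof clarify
  fix x y assume xy: "(x, y) \<in> support_set M (\<lambda>w. (Z w, W w))"
  have "0 < prob {w \<in> space M. Z w \<in> ball x e} \<and> 0 < prob {w \<in> space M. W w \<in> ball y e}"
    if "0 < e" for e
  proof -
    let ?J = "{w \<in> space M. (Z w, W w) \<in> ball (x, y) e}"
    have pos: "0 < prob ?J"
      using xy that by (auto simp: support_set_def)
    have "?J \<subseteq> {w \<in> space M. Z w \<in> ball x e}" "?J \<subseteq> {w \<in> space M. W w \<in> ball y e}"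
      using dist_fst_le[of "(x, y)"] dist_snd_le[of "(x, y)"] by (fastforce intro: le_less_trans)+
    moreover have "{w \<in> space M. Z w \<in> ball x e} \<in> sets M" "{w \<in> space M. W w \<in> ball y e} \<in> sets M"
      using measurable_sets[OF assms(1), of "ball x e"] measurable_sets[OF assms(2), of "ball y e"]
      by (auto simp: vimage_def Int_def conj_commute simp del: mem_ball)
    ultimately have "prob ?J \<le> prob {w \<in> space M. Z w \<in> ball x e}"
      "prob ?J \<le> prob {w \<in> space M. W w \<in> ball y e}"
      by (blast intro: finite_measure_mono)+
    with pos show ?thesis
      by linarith
  qed
  then show "x \<in> support_set M Z \<and> y \<in> support_set M W"
    by (simp add: support_set_def)
qed

lemma (in prob_space) indep_var_support_set_pair:
  fixes Z W :: "'a \<Rightarrow> 'b::metric_space"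
  assumes indep: "indep_var borel Z borel W"
  shows "support_set M (\<lambda>w. (Z w, W w)) = support_set M Z \<times> support_set M W"
proof (rule antisym)
  have Z: "Z \<in> borel_measurable M" and W: "W \<in> borel_measurable M"
    using indep by (auto dest: indep_var_rv1 indep_var_rv2)
  then show "support_set M (\<lambda>w. (Z w, W w)) \<subseteq> support_set M Z \<times> support_set M W"
    by (rule support_set_pair_subset)
  show "support_set M Z \<times> support_set M W \<subseteq> support_set M (\<lambda>w. (Z w, W w))"
  proof clarify
    fix x y assume x: "x \<in> support_set M Z" and y: "y \<in> support_set M W"
    have "0 < prob {w \<in> space M. (Z w, W w) \<in> ball (x, y) e}" if "0 < e" for e
    proof -
      let ?R = "(\<lambda>w. (Z w, W w)) -` (ball x (e / 2) \<times> ball y (e / 2)) \<inter> space M"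
      have "0 < prob (Z -` ball x (e / 2) \<inter> space M)" "0 < prob (W -` ball y (e / 2) \<inter> space M)"
        using x y that by (auto simp: support_set_def vimage_def Int_def conj_commute
            simp del: mem_ball)
      then have "0 < prob ?R"
        by (subst indep_varD[OF indep]) auto
      also have "prob ?R \<le> prob {w \<in> space M. (Z w, W w) \<in> ball (x, y) e}"
        using ball_Times_ball_subset_ball[of x e y] pair_in_ball_measurable[OF Z W]
        by (intro finite_measure_mono) (auto simp del: mem_ball)
      finally show ?thesis .
    qed
    then show "(x, y) \<in> support_set M (\<lambda>w. (Z w, W w))"
      by (simp add: support_set_def)
  qed
qed

theorem proposition1:
  fixes P :: "(real \<times> real) measure"
  assumes "prob_space P"
    and "sets P = sets borel"
    and "amiable P fst"
    and "amiable P snd"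
    and "prob_space.indep_var P borel fst borel snd"
  shows "support_set P (\<lambda>w. (fst w, snd w)) = support_set P fst \<times> support_set P snd"
  using assms(1,5) by (rule prob_space.indep_var_support_set_pair)

end
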